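(* Consider the LL/SC algorithm given in the context (for $m$ objects, $n$ processes, at most $k$ outstanding LL operations in total). Each of the methods $\mathrm{LL}$, $\mathrm{CL}$, $\mathrm{Read}$, $\mathrm{VL}$ has constant step complexity, i.e. the number of steps of any call is bounded by a constant independent of $n,m,k$. The expected step complexity of $\mathrm{SC}$ under a weak adaptive adversary is constant, i.e. the expected number of steps of any $\mathrm{SC}$ call is bounded by a constant independent of $n,m,k$.
   Context: Model. $n$ asynchronous processes communicate by atomic operations (steps) on shared objects. A CAS object supports $\mathrm{Read}()$ and $\mathrm{CAS}(old,new)$, which, if the current value equals $old$, writes $new$ and returns True (success), and otherwise returns False and changes nothing (failure). A FAID object stores an integer in a range $\{0,\dots,M-1\}$ and supports $\mathrm{Read}()$, $\mathrm{FAI}()$, $\mathrm{FAD}()$; each returns the current value, and FAI/FAD additionally increment/decrement it (leaving the range would be an overflow, with unspecified effect). Each process performs method calls one at a time; it is idle if it has no pending call. Steps are arbitrarily interleaved. A point is the time of an event of the execution. Local computation takes no time; a call (also an internal one) responds at the point of its last shared memory step (or at its invocation if it has none). Data. Constants: $U$ = set of values, $m$ objects, $n$ processes, bound $k\ge 1$. Shared: CAS objects $L[i]$, $1\le i\le m$, storing pairs (val, tag) in $U\times\{0,\dots,2k\}$, initially $(u_i,0)$ with given $u_i\in U$; FAID objects $C[i]$, $1\le i\le m$, range $\{0,\dots,n\}$, initially $0$; FAID objects $R[g]$, $1\le g\le 2k$, range $\{0,\dots,k\}$, initially $0$. Each process has a local persistent dictionary $d$ with keys $1,\dots,m$ and values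 in $U\times\{0,\dots,2k\}$ or $\bot$ (initially all $\bot$). $x.\mathrm{val}$, $x.\mathrm{tag}$ are the components of a pair $x$. Algorithm ($i\in\{1,\dots,m\}$, $u\in U$). LL(i): (L1) if $d[i]\ne\bot$, call CL(i). (L2) $C[i].\mathrm{FAI}()$. (L3) $(val,tag)\gets L[i].\mathrm{Read}()$. (L4) $d[i]\gets(val,tag)$. (L5) if $tag=0$ return $val$. (L6) $R[tag].\mathrm{FAI}()$. (L7) $(val',tag')\gets L[i].\mathrm{Read}()$. (L8) if $(val,tag)=(val',tag')$ return $val'$. (L9) if $tag'=0$: $R[tag].\mathrm{FAD}()$; $d[i]\gets(val',0)$; return $val'$. (L10) call CL(i). (L11) return $val$. SC(i,u): (S1) if $d[i]=\bot$ return False. (S2) repeat: $tag'\gets$ uniform independent random sample from $\{1,\dots,2k\}$; until $R[tag'].\mathrm{Read}()=0$. (S3) $result\gets L[i].\mathrm{CAS}(d[i],(u,tag'))$. (S4) if $result$ = False, $result\gets L[i].\mathrm{CAS}((d[i].\mathrm{val},0),(u,tag'))$. (S5) call CL(i). (S6) return $result$. CL(i): (K1) if $d[i]=\bot$ return. (K2) if $d[i].\mathrm{tag}\ne0$, $R[d[i].\mathrm{tag}].\mathrm{FAD}()$. (K3) $d[i]\gets\bot$. (K4) if $C[i].\mathrm{FAD}()>1$ return. (K5) $(val,tag)\gets L[i].\mathrm{Read}()$. (K6) if $tag=0$ return. (K7) $R[tag].\mathrm{FAI}()$. (K8) if $L[i].\mathrm{Read}()=(val,tag)$ then (K9) if $C[i].\mathrm{Read}()=0$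 then (K10) $L[i].\mathrm{CAS}((val,tag),(val,0))$. (K11) $R[tag].\mathrm{FAD}()$. Read(i): return $L[i].\mathrm{Read}().\mathrm{val}$. VL(i): (V1) if $d[i]=\bot$ return False. (V2) if $L[i].\mathrm{Read}().\mathrm{tag}\in\{d[i].\mathrm{tag},0\}$ return True. (V3) call CL(i). (V4) return False. Outstanding LL. A process begins to have an outstanding LL(i) when it invokes LL(i), and ceases to have it when it completes an SC(i,·), a CL(i), or a VL(i) returning False (only calls made directly, not internal CL calls, count). A process has at most one outstanding LL per object. Standing assumption: at every point, the total number of outstanding LL operations over all processes and objects is at most $k$. Weak adaptive adversary: the scheduler determines at each point which process takes the next step, knowing all past events including all past random outcomes, but it cannot intervene between a process's random choice and that process's following shared memory step: the two are executed with no step of another process in between. *)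

theory Defs
  imports "HOL-Probability.Probability"
begin

text \<open>Processes are \<open>1, \<dots>, n\<close> and objects are \<open>1, \<dots>, m\<close>. State components are total functions
  on \<open>nat\<close>; only indices in range are ever used.\<close>

datatype 'u call = LL nat | SC nat 'u | CL nat | VL nat | Rd nat

fun obj :: "'u call \<Rightarrow> nat" where
  "obj (LL i) = i"
| "obj (SC i u) = i"
| "obj (CL i) = i"
| "obj (VL i) = i"
| "obj (Rd i) = i"

datatype 'u resp = Val 'u | Bool bool | Done

text \<open>What a process does once its current execution of \<open>CL\<close> (direct or internal) is finished:
  respond to its method call, or continue with line L2 of \<open>LL\<close>.\<close>

datatype 'u cont = Return "'u resp" | ToL2

text \<open>The line of the next shared memory step of a process. The arguments are the local variables
  that are still needed: the pair \<open>(val, tag)\<close> read before, the new value \<open>u\<close>, the sampled tag.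
  All local computation between two shared memory steps is performed together with the former step.
  Line S2 is the loop body: it samples a tag and reads \<open>R\<close> at that tag.\<close>

datatype 'u pc =
    L2 | L3 | L6 "'u \<times> nat" | L7 "'u \<times> nat" | L9 "'u \<times> nat" 'u
  | S2 'u | S3 'u nat | S4 'u nat
  | K2 "'u cont" | K4 "'u cont" | K5 "'u cont" | K7 "'u \<times> nat" "'u cont" | K8 "'u \<times> nat" "'u cont"
  | K9 "'u \<times> nat" "'u cont" | K10 "'u \<times> nat" "'u cont" | K11 "'u \<times> nat" "'u cont"
  | RD | V2

datatype 'u status = Idle | Busy "'u call" "'u pc"

record 'u config =
  objL :: "nat \<Rightarrow> 'u \<times> nat"
  objC :: "nat \<Rightarrow> int"
  objR :: "nat \<Rightarrow> int"
  dict :: "nat \<Rightarrow> nat \<Rightarrow> ('u \<times> nat) option"    \<comment> \<open>process, key\<close>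
  status :: "nat \<Rightarrow> 'u status"
  last_resp :: "nat \<Rightarrow> 'u resp option"
  outst :: "(nat \<times> nat) set"                 \<comment> \<open>\<open>(p, i)\<close>: process \<open>p\<close> has an outstanding \<open>LL(i)\<close>\<close>

text \<open>In \<open>Step p s\<close>, \<open>s\<close> is the tag sampled in this step, if it executes line S2. The configuration is
  a function of the list of past events, so this list carries all information about the past.\<close>

datatype 'u event = Invoke nat "'u call" | Step nat "nat option"

text \<open>The effect of an overflow of a FAID object is unspecified: \<open>overflow h\<close>, an arbitrary function of
  the past, is the returned value and the new value of the object.\<close>

record 'u instance_params =
  procs :: nat
  objs :: nat
  bound :: nat
  vals :: "'u set"
  init_val :: "nat \<Rightarrow> 'u"
  overflow :: "'u event list \<Rightarrow> int \<times> int"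

definition valid_params :: "'u instance_params \<Rightarrow> bool" where
  "valid_params I \<longleftrightarrow> bound I \<ge> 1 \<and> (\<forall>i\<in>{1..objs I}. init_val I i \<in> vals I)"

definition init_config :: "'u instance_params \<Rightarrow> 'u config" where
  "init_config I = \<lparr>objL = (\<lambda>i. (init_val I i, 0)), objC = (\<lambda>i. 0), objR = (\<lambda>g. 0),
     dict = (\<lambda>p i. None), status = (\<lambda>p. Idle), last_resp = (\<lambda>p. None), outst = {}\<rparr>"


subsection \<open>Shared objects\<close>

text \<open>Operations map the current value to the returned value and the new value. \<open>M\<close> is the size of the
  range of a FAID object and \<open>ov\<close> the outcome of an overflow.\<close>

definition cas :: "'a \<Rightarrow> 'a \<Rightarrow> 'a \<Rightarrow> bool \<times> 'a" where
  "cas old new x = (if x = old then (True, new) else (False, x))"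

definition fai :: "nat \<Rightarrow> int \<times> int \<Rightarrow> int \<Rightarrow> int \<times> int" where
  "fai M ov x = (if x + 1 \<in> {0..<int M} then (x, x + 1) else ov)"

definition fad :: "nat \<Rightarrow> int \<times> int \<Rightarrow> int \<Rightarrow> int \<times> int" where
  "fad M ov x = (if x - 1 \<in> {0..<int M} then (x, x - 1) else ov)"

definition cas_L :: "nat \<Rightarrow> 'u \<times> nat \<Rightarrow> 'u \<times> nat \<Rightarrow> 'u config \<Rightarrow> bool \<times> 'u config" where
  "cas_L i old new c = (let (b, x) = cas old new (objL c i) in (b, c\<lparr>objL := (objL c)(i := x)\<rparr>))"

definition fai_C :: "'u instance_params \<Rightarrow> int \<times> int \<Rightarrow> nat \<Rightarrow> 'u config \<Rightarrow> int \<times> 'u config" where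
  "fai_C I ov i c = (let (r, x) = fai (procs I + 1) ov (objC c i) in (r, c\<lparr>objC := (objC c)(i := x)\<rparr>))"

definition fad_C :: "'u instance_params \<Rightarrow> int \<times> int \<Rightarrow> nat \<Rightarrow> 'u config \<Rightarrow> int \<times> 'u config" where
  "fad_C I ov i c = (let (r, x) = fad (procs I + 1) ov (objC c i) in (r, c\<lparr>objC := (objC c)(i := x)\<rparr>))"

definition fai_R :: "'u instance_params \<Rightarrow> int \<times> int \<Rightarrow> nat \<Rightarrow> 'u config \<Rightarrow> int \<times> 'u config" where
  "fai_R I ov g c = (let (r, x) = fai (bound I + 1) ov (objR c g) in (r, c\<lparr>objR := (objR c)(g := x)\<rparr>))"

definition fad_R :: "'u instance_params \<Rightarrow> int \<times> int \<Rightarrow> nat \<Rightarrow> 'u config \<Rightarrow> int \<times> 'u config" where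
  "fad_R I ov g c = (let (r, x) = fad (bound I + 1) ov (objR c g) in (r, c\<lparr>objR := (objR c)(g := x)\<rparr>))"


subsection \<open>The algorithm\<close>

definition set_dict :: "nat \<Rightarrow> nat \<Rightarrow> ('u \<times> nat) option \<Rightarrow> 'u config \<Rightarrow> 'u config" where
  "set_dict p i x c = c\<lparr>dict := (dict c)(p := (dict c p)(i := x))\<rparr>"

definition goto :: "nat \<Rightarrow> 'u call \<Rightarrow> 'u pc \<Rightarrow> 'u config \<Rightarrow> 'u config" where
  "goto p M q c = c\<lparr>status := (status c)(p := Busy M q)\<rparr>"

text \<open>Whether completion of the (direct) method call with this response ends an outstanding \<open>LL\<close>.\<close>

fun ends_outstanding :: "'u call \<Rightarrow> 'u resp \<Rightarrow> bool" where
  "ends_outstanding (SC i u) r = True"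
| "ends_outstanding (CL i) r = True"
| "ends_outstanding (VL i) r = (r = Bool False)"
| "ends_outstanding (LL i) r = False"
| "ends_outstanding (Rd i) r = False"

definition respond :: "nat \<Rightarrow> 'u call \<Rightarrow> 'u resp \<Rightarrow> 'u config \<Rightarrow> 'u config" where
  "respond p M r c = c\<lparr>status := (status c)(p := Idle), last_resp := (last_resp c)(p := Some r),
     outst := (if ends_outstanding M r then outst c - {(p, obj M)} else outst c)\<rparr>"

definition resume :: "nat \<Rightarrow> 'u call \<Rightarrow> 'u cont \<Rightarrow> 'u config \<Rightarrow> 'u config" where
  "resume p M \<kappa> c = (case \<kappa> of Return r \<Rightarrow> respond p M r c | ToL2 \<Rightarrow> goto p M L2 c)"

text \<open>Invocation of \<open>CL\<close> on the object of \<open>M\<close>, directly or from within the method call \<open>M\<close>, up to its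
  first shared memory step: lines K1, K2 (test), and K3 if there is no step in K2.\<close>

definition call_CL :: "nat \<Rightarrow> 'u call \<Rightarrow> 'u cont \<Rightarrow> 'u config \<Rightarrow> 'u config" where
  "call_CL p M \<kappa> c = (case dict c p (obj M) of
       None \<Rightarrow> resume p M \<kappa> c
     | Some (v, tag) \<Rightarrow>
         if tag \<noteq> 0 then goto p M (K2 \<kappa>) c
         else goto p M (K4 \<kappa>) (set_dict p (obj M) None c))"

text \<open>Invocation of a method call, with the local computation up to its first shared memory step.\<close>

fun invoke :: "nat \<Rightarrow> 'u call \<Rightarrow> 'u config \<Rightarrow> 'u config" where
  "invoke p (LL i) c =
     (let c' = c\<lparr>outst := insert (p, i) (outst c)\<rparr> in
      if dict c' p i \<noteq> None then call_CL p (LL i) ToL2 c' else goto p (LL i) L2 c')"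
| "invoke p (SC i u) c =
     (if dict c p i = None then respond p (SC i u) (Bool False) c else goto p (SC i u) (S2 u) c)"
| "invoke p (CL i) c = call_CL p (CL i) (Return Done) c"
| "invoke p (VL i) c =
     (if dict c p i = None then respond p (VL i) (Bool False) c else goto p (VL i) V2 c)"
| "invoke p (Rd i) c = goto p (Rd i) RD c"

text \<open>The step of process \<open>p\<close> in line \<open>q\<close> of its pending call \<open>M\<close>. \<open>smp\<close> is the random sample (used in
  line S2 only), \<open>ov\<close> the outcome of an overflow.\<close>

definition exec_line ::
  "'u instance_params \<Rightarrow> int \<times> int \<Rightarrow> nat \<Rightarrow> nat \<Rightarrow> 'u call \<Rightarrow> 'u pc \<Rightarrow> 'u config \<Rightarrow> 'u config" where
  "exec_line I ov smp p M q c = (let i = obj M in case q of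
       L2 \<Rightarrow> goto p M L3 (snd (fai_C I ov i c))
     | L3 \<Rightarrow> (let x = objL c i; c' = set_dict p i (Some x) c in
         if snd x = 0 then respond p M (Val (fst x)) c' else goto p M (L6 x) c')
     | L6 x \<Rightarrow> goto p M (L7 x) (snd (fai_R I ov (snd x) c))
     | L7 x \<Rightarrow> (let x' = objL c i in
         if x = x' then respond p M (Val (fst x')) c
         else if snd x' = 0 then goto p M (L9 x (fst x')) c
         else call_CL p M (Return (Val (fst x))) c)
     | L9 x v' \<Rightarrow> respond p M (Val v') (set_dict p i (Some (v', 0)) (snd (fad_R I ov (snd x) c)))
     | S2 u \<Rightarrow> if objR c smp = 0 then goto p M (S3 u smp) c else goto p M (S2 u) c
     | S3 u tag' \<Rightarrow> (let (b, c') = cas_L i (the (dict c p i)) (u, tag') c in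
         if b then call_CL p M (Return (Bool True)) c' else goto p M (S4 u tag') c')
     | S4 u tag' \<Rightarrow> (let (b, c') = cas_L i (fst (the (dict c p i)), 0) (u, tag') c in
         call_CL p M (Return (Bool b)) c')
     | K2 \<kappa> \<Rightarrow> goto p M (K4 \<kappa>)
         (set_dict p i None (snd (fad_R I ov (snd (the (dict c p i))) c)))
     | K4 \<kappa> \<Rightarrow> (let (r, c') = fad_C I ov i c in
         if r > 1 then resume p M \<kappa> c' else goto p M (K5 \<kappa>) c')
     | K5 \<kappa> \<Rightarrow> (let x = objL c i in
         if snd x = 0 then resume p M \<kappa> c else goto p M (K7 x \<kappa>) c)
     | K7 x \<kappa> \<Rightarrow> goto p M (K8 x \<kappa>) (snd (fai_R I ov (snd x) c))
     | K8 x \<kappa> \<Rightarrow> if objL c i = x then goto p M (K9 x \<kappa>) c else goto p M (K11 x \<kappa>) c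
     | K9 x \<kappa> \<Rightarrow> if objC c i = 0 then goto p M (K10 x \<kappa>) c else goto p M (K11 x \<kappa>) c
     | K10 x \<kappa> \<Rightarrow> goto p M (K11 x \<kappa>) (snd (cas_L i x (fst x, 0) c))
     | K11 x \<kappa> \<Rightarrow> resume p M \<kappa> (snd (fad_R I ov (snd x) c))
     | RD \<Rightarrow> respond p M (Val (fst (objL c i))) c
     | V2 \<Rightarrow> if snd (objL c i) \<in> {snd (the (dict c p i)), 0} then respond p M (Bool True) c
         else call_CL p M (Return (Bool False)) c)"

definition step :: "'u instance_params \<Rightarrow> int \<times> int \<Rightarrow> nat \<Rightarrow> nat \<Rightarrow> 'u config \<Rightarrow> 'u config" where
  "step I ov smp p c =
     (case status c p of Idle \<Rightarrow> c | Busy M q \<Rightarrow> exec_line I ov smp p M q c)"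

fun sampling :: "'u status \<Rightarrow> bool" where
  "sampling (Busy M (S2 u)) = True"
| "sampling _ = False"


subsection \<open>Executions under a weak adaptive adversary\<close>

text \<open>Given the list of past events (oldest first), the adversary stops (\<open>None\<close>), lets an idle process
  invoke a method call, or lets a busy process take its next step.\<close>

datatype 'u action = Call nat "'u call" | Sched nat

type_synonym 'u adversary = "'u event list \<Rightarrow> 'u action option"

text \<open>The event with index \<open>t\<close> uses the sample \<open>\<omega> !! t\<close> if it executes line S2. The adversary chooses
  this event without knowing \<open>\<omega> !! t\<close>, and sampling and the subsequent read form one event.\<close>

primrec run :: "'u instance_params \<Rightarrow> 'u adversary \<Rightarrow> nat stream \<Rightarrow> nat \<Rightarrow> 'u config \<times> 'u event list" where
  "run I \<sigma> \<omega> 0 = (init_config I, [])"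
| "run I \<sigma> \<omega> (Suc t) = (let (c, h) = run I \<sigma> \<omega> t in
     case \<sigma> h of
       None \<Rightarrow> (c, h)
     | Some (Call p M) \<Rightarrow> (invoke p M c, h @ [Invoke p M])
     | Some (Sched p) \<Rightarrow>
         (step I (overflow I h) (\<omega> !! t) p c,
          h @ [Step p (if sampling (status c p) then Some (\<omega> !! t) else None)]))"

definition config_at :: "'u instance_params \<Rightarrow> 'u adversary \<Rightarrow> nat stream \<Rightarrow> nat \<Rightarrow> 'u config" where
  "config_at I \<sigma> \<omega> t = fst (run I \<sigma> \<omega> t)"

definition history :: "'u instance_params \<Rightarrow> 'u adversary \<Rightarrow> nat stream \<Rightarrow> nat \<Rightarrow> 'u event list" where
  "history I \<sigma> \<omega> t = snd (run I \<sigma> \<omega> t)"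

definition event_at :: "'u instance_params \<Rightarrow> 'u adversary \<Rightarrow> nat stream \<Rightarrow> nat \<Rightarrow> 'u event option" where
  "event_at I \<sigma> \<omega> t =
     (let h = history I \<sigma> \<omega> (Suc t) in if t < length h then Some (h ! t) else None)"

definition samples :: "'u instance_params \<Rightarrow> nat stream measure" where
  "samples I = stream_space (measure_pmf (pmf_of_set {1..2 * bound I}))"

fun admissible :: "'u instance_params \<Rightarrow> 'u config \<Rightarrow> 'u action \<Rightarrow> bool" where
  "admissible I c (Call p M) \<longleftrightarrow>
     p \<in> {1..procs I} \<and> status c p = Idle \<and> obj M \<in> {1..objs I} \<and> (\<forall>i u. M = SC i u \<longrightarrow> u \<in> vals I)"
| "admissible I c (Sched p) \<longleftrightarrow> p \<in> {1..procs I} \<and> status c p \<noteq> Idle"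

text \<open>The second conjunct is the standing assumption on outstanding \<open>LL\<close> operations.\<close>

definition weak_adversary :: "'u instance_params \<Rightarrow> 'u adversary \<Rightarrow> bool" where
  "weak_adversary I \<sigma> \<longleftrightarrow> (\<forall>\<omega>\<in>streams {1..2 * bound I}. \<forall>t.
     (\<forall>a. \<sigma> (history I \<sigma> \<omega> t) = Some a \<longrightarrow> admissible I (config_at I \<sigma> \<omega> t) a) \<and>
     card (outst (config_at I \<sigma> \<omega> t)) \<le> bound I)"

text \<open>The number of steps, possibly infinite, of the method call that \<open>p\<close> invokes in the event with
  index \<open>t\<close>: all steps of \<open>p\<close> after \<open>t\<close> and before its next invocation, since an idle process takes
  no steps. Steps of internal calls are included.\<close>

definition call_steps ::
  "'u instance_params \<Rightarrow> 'u adversary \<Rightarrow> nat stream \<Rightarrow> nat \<Rightarrow> nat \<Rightarrow> ennreal" where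
  "call_steps I \<sigma> \<omega> p t = emeasure (count_space UNIV)
     {s. s > t \<and> (\<exists>x. event_at I \<sigma> \<omega> s = Some (Step p x)) \<and>
         (\<forall>r M. t < r \<and> r < s \<longrightarrow> event_at I \<sigma> \<omega> r \<noteq> Some (Invoke p M))}"

definition prefix_event ::
  "'u instance_params \<Rightarrow> 'u adversary \<Rightarrow> 'u event list \<Rightarrow> nat stream set" where
  "prefix_event I \<sigma> h = {\<omega> \<in> space (samples I). history I \<sigma> \<omega> (length h) = h}"

text \<open>The expected number of steps of the call that \<open>p\<close> invokes in the last event of \<open>h\<close>, conditional on
  the execution starting with \<open>h\<close>.\<close>

definition expected_call_steps ::
  "'u instance_params \<Rightarrow> 'u adversary \<Rightarrow> 'u event list \<Rightarrow> nat \<Rightarrow> ennreal" where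
  "expected_call_steps I \<sigma> h p =
     (\<integral>\<^sup>+\<omega>. call_steps I \<sigma> \<omega> p (length h - 1) \<partial>uniform_measure (samples I) (prefix_event I \<sigma> h))"

end

(* An entry of R counts the pairs (p, i) for which p currently holds a reference for object i, namely
   a nonzero tag in its dictionary (not yet counted before line L6) or a tag that an execution of CL
   has registered in line K7. A pair that holds a reference has an outstanding LL, so R never
   overflows, at most k of its 2k entries are nonzero at any point, and a sample in line S2 succeeds with probability at least 1/2. Hence a bounded potential of
   the program counter, which drops by at least 1 in every step, in expectation for line S2,
   bounds the expected number of steps. *)

theory Submission
  imports Defs
begin

section \<open>The references counted by the array R\<close>

text \<open>One optional tag per pair suffices: \<open>CL\<close> clears the dictionary entry before
  K7 can register another tag. An \<open>LL\<close> stays outstanding until the response that ends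
  it, hence also while \<open>CL\<close> works after clearing the entry. A pair about to increment
  \<open>R\<close> is outstanding but holds nothing, which leaves at most k - 1 holders and room for
  the increment.

  The obstacle for \<open>SC\<close> is that the adversary decides, depending on earlier samples,
  when the next retry happens. Time is therefore the index of the global event, and events of other
  processes leave the potential of \<open>p\<close> unchanged. Event s is chosen from the samples
  before s, so it suffices to average over sample s with the earlier ones fixed. Summing over all s
  also covers calls that never return.

  The constant 20 is 8 steps of \<open>CL\<close> plus 12 of \<open>LL\<close>, for an
  \<open>LL\<close> that starts with an internal \<open>CL\<close>.\<close>

fun dict_ref :: "('u \<times> nat) option \<Rightarrow> nat option" where
  "dict_ref None = None"
| "dict_ref (Some x) = (if snd x = 0 then None else Some (snd x))"

text \<open>At L6 the dictionary already contains a tag that \<open>R\<close> does not count yet. At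
  K8 to K11 the entry is gone and the reference is to the tag read in K5. Elsewhere, including K2
  and L9 just before their decrement, the entry alone decides.\<close>

fun pc_ref :: "'u pc \<Rightarrow> ('u \<times> nat) option \<Rightarrow> nat option" where
  "pc_ref (L6 x) d = None"
| "pc_ref (K8 x \<kappa>) d = Some (snd x)"
| "pc_ref (K9 x \<kappa>) d = Some (snd x)"
| "pc_ref (K10 x \<kappa>) d = Some (snd x)"
| "pc_ref (K11 x \<kappa>) d = Some (snd x)"
| "pc_ref q d = dict_ref d"

fun status_ref :: "'u status \<Rightarrow> nat \<Rightarrow> ('u \<times> nat) option \<Rightarrow> nat option" where
  "status_ref Idle i d = dict_ref d"
| "status_ref (Busy M q) i d = (if obj M = i then pc_ref q d else dict_ref d)"

definition ref_at :: "'u config \<Rightarrow> nat \<times> nat \<Rightarrow> nat option" where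
  "ref_at c = (\<lambda>(p, i). status_ref (status c p) i (dict c p i))"

fun cont_ok :: "'u call \<Rightarrow> 'u cont \<Rightarrow> bool" where
  "cont_ok M (Return r) = True"
| "cont_ok M ToL2 = (\<exists>i. M = LL i)"

text \<open>The kind of call is recorded where a response may leave a dictionary entry behind, and
  on the lines leading there: such a response must not end the outstanding \<open>LL\<close>. The
  lines of \<open>CL\<close> keep \<open>b\<close> after the entry is gone, since they may hold a
  registered tag.\<close>

fun pc_ok :: "'u call \<Rightarrow> 'u pc \<Rightarrow> ('u \<times> nat) option \<Rightarrow> bool \<Rightarrow> bool" where
  "pc_ok M L2 d b \<longleftrightarrow> (\<exists>i. M = LL i) \<and> d = None \<and> b"
| "pc_ok M L3 d b \<longleftrightarrow> (\<exists>i. M = LL i) \<and> d = None \<and> b"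
| "pc_ok M (L6 x) d b \<longleftrightarrow> (\<exists>i. M = LL i) \<and> d = Some x \<and> snd x \<noteq> 0 \<and> b"
| "pc_ok M (L7 x) d b \<longleftrightarrow> (\<exists>i. M = LL i) \<and> d = Some x \<and> snd x \<noteq> 0 \<and> b"
| "pc_ok M (L9 x v) d b \<longleftrightarrow> (\<exists>i. M = LL i) \<and> d = Some x \<and> snd x \<noteq> 0 \<and> b"
| "pc_ok M (S2 u) d b \<longleftrightarrow> d \<noteq> None \<and> b"
| "pc_ok M (S3 u g) d b \<longleftrightarrow> d \<noteq> None \<and> b"
| "pc_ok M (S4 u g) d b \<longleftrightarrow> d \<noteq> None \<and> b"
| "pc_ok M (K2 \<kappa>) d b \<longleftrightarrow> (\<exists>x. d = Some x \<and> snd x \<noteq> 0) \<and> b \<and> cont_ok M \<kappa>"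
| "pc_ok M (K4 \<kappa>) d b \<longleftrightarrow> d = None \<and> b \<and> cont_ok M \<kappa>"
| "pc_ok M (K5 \<kappa>) d b \<longleftrightarrow> d = None \<and> b \<and> cont_ok M \<kappa>"
| "pc_ok M (K7 x \<kappa>) d b \<longleftrightarrow> d = None \<and> b \<and> cont_ok M \<kappa>"
| "pc_ok M (K8 x \<kappa>) d b \<longleftrightarrow> d = None \<and> b \<and> cont_ok M \<kappa>"
| "pc_ok M (K9 x \<kappa>) d b \<longleftrightarrow> d = None \<and> b \<and> cont_ok M \<kappa>"
| "pc_ok M (K10 x \<kappa>) d b \<longleftrightarrow> d = None \<and> b \<and> cont_ok M \<kappa>"
| "pc_ok M (K11 x \<kappa>) d b \<longleftrightarrow> d = None \<and> b \<and> cont_ok M \<kappa>"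
| "pc_ok M RD d b \<longleftrightarrow> (\<exists>i. M = Rd i)"
| "pc_ok M V2 d b \<longleftrightarrow> (\<exists>i. M = VL i) \<and> d \<noteq> None \<and> b"

fun status_ok :: "'u status \<Rightarrow> nat \<Rightarrow> ('u \<times> nat) option \<Rightarrow> bool \<Rightarrow> bool" where
  "status_ok Idle i d b \<longleftrightarrow> (d \<noteq> None \<longrightarrow> b)"
| "status_ok (Busy M q) i d b \<longleftrightarrow> (d \<noteq> None \<longrightarrow> b) \<and> (obj M = i \<longrightarrow> pc_ok M q d b)"

text \<open>Both directions of the equality matter: the upper bound on \<open>R\<close> keeps
  \<open>fai\<close> in range, the lower bound keeps \<open>fad\<close> from falling below
  0.\<close>

definition consistent :: "'u config \<Rightarrow> bool" where
  "consistent c \<longleftrightarrow> finite (outst c) \<and>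
     (\<forall>p i. status_ok (status c p) i (dict c p i) ((p, i) \<in> outst c)) \<and>
     (\<forall>g. objR c g = int (card {x. ref_at c x = Some g}))"

lemma dict_ref_SomeD: "dict_ref d = Some g \<Longrightarrow> d \<noteq> None"
  by (cases d) auto

lemma status_ref_outst: "status_ok st i d b \<Longrightarrow> status_ref st i d = Some g \<Longrightarrow> b"
proof (cases st)
  case (Busy M q)
  then show "status_ok st i d b \<Longrightarrow> status_ref st i d = Some g \<Longrightarrow> b"
    by (cases q) (auto split: if_splits dest: dict_ref_SomeD)
qed (auto dest: dict_ref_SomeD)

section \<open>Counting references against outstanding operations\<close>

lemma ref_at_outst:
  assumes "consistent c" "ref_at c x = Some g"
  shows "x \<in> outst c"
  using assms status_ref_outst unfolding consistent_def ref_at_def by (fastforce split: prod.splits)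

lemma card_refs_le:
  assumes "consistent c"
  shows "card {x. ref_at c x = Some g} \<le> card (outst c)"
  using assms ref_at_outst[OF assms] by (intro card_mono) (auto simp: consistent_def)

text \<open>The pair \<open>x\<close> is outstanding without being a holder, so the inclusion of the
  holders in \<open>outst c\<close> is strict.\<close>

lemma card_refs_less:
  assumes "consistent c" "x \<in> outst c" "ref_at c x = None"
  shows "card {x. ref_at c x = Some g} < card (outst c)"
proof (rule psubset_card_mono)
  show "finite (outst c)" using assms(1) by (simp add: consistent_def)
  have "x \<notin> {x. ref_at c x = Some g}" using assms(3) by simp
  then show "{x. ref_at c x = Some g} \<subset> outst c"
    using ref_at_outst[OF assms(1)] assms(2) by blast
qed

lemma card_refs_pos:
  assumes "consistent c" "ref_at c x = Some g"
  shows "card {x. ref_at c x = Some g} > 0"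
proof -
  have "finite {x. ref_at c x = Some g}"
    using assms(1) ref_at_outst[OF assms(1)] by (auto simp: consistent_def intro: finite_subset[of _ "outst c"])
  with assms(2) show ?thesis by (subst card_gt_0_iff) blast
qed

text \<open>Every nonzero entry has a holder, so mapping outstanding pairs to their tags hits all
  nonzero entries. The junk value of \<open>the\<close> on pairs without a reference does no harm to
  this inclusion.\<close>

lemma card_nonzero_R_le:
  assumes "consistent c"
  shows "card {g. objR c g \<noteq> 0} \<le> card (outst c)" "finite {g. objR c g \<noteq> 0}"
proof -
  have *: "{g. objR c g \<noteq> 0} \<subseteq> (\<lambda>x. the (ref_at c x)) ` outst c"
  proof
    fix g assume "g \<in> {g. objR c g \<noteq> 0}"
    hence "card {x. ref_at c x = Some g} \<noteq> 0"
      using assms by (simp add: consistent_def)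
    then have "{x. ref_at c x = Some g} \<noteq> {}" by (metis card.empty)
    then obtain x where "ref_at c x = Some g" by auto
    thus "g \<in> (\<lambda>x. the (ref_at c x)) ` outst c"
      using ref_at_outst[OF assms] by (intro image_eqI[of _ _ x]) auto
  qed
  have fin: "finite (outst c)" using assms by (simp add: consistent_def)
  show "finite {g. objR c g \<noteq> 0}" using * fin by (meson finite_imageI finite_subset)
  show "card {g. objR c g \<noteq> 0} \<le> card (outst c)"
    using card_mono[OF finite_imageI[OF fin] *] card_image_le[OF fin] le_trans by blast
qed

section \<open>Preservation of the invariant\<close>

lemma card_fun_upd:
  assumes "finite {x. H x \<noteq> None}"
  shows "int (card {x. (H(a := v)) x = Some g}) =
    int (card {x. H x = Some g}) + of_bool (v = Some g) - of_bool (H a = Some g)"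
proof -
  let ?A = "{x. H x = Some g} - {a}"
  have fin: "finite ?A" using assms by (auto intro: finite_subset[OF _ assms])
  have "{x. (H(a := v)) x = Some g} = (if v = Some g then insert a ?A else ?A)" by auto
  moreover have "{x. H x = Some g} = (if H a = Some g then insert a ?A else ?A)" by auto
  ultimately show ?thesis
    using fin by (smt (verit) Diff_iff card_insert_disjoint insertI1 of_bool_eq of_nat_Suc)
qed

text \<open>An event touches one pair only: the acting process and the object of its call. By
  \<open>st\<close> and \<open>st'\<close>, the program counter of \<open>p\<close> concerns no
  object but \<open>i\<close> before and after the event, so nothing changes at other pairs and only
  the conditions at \<open>(p, i)\<close> remain to be checked.\<close>

lemma consistent_update:
  assumes c: "consistent c"
    and fin: "finite (outst c')"
    and dict: "\<And>p' i'. (p', i') \<noteq> (p, i) \<Longrightarrow> dict c' p' i' = dict c p' i'"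
    and outst: "\<And>p' i'. (p', i') \<noteq> (p, i) \<Longrightarrow> (p', i') \<in> outst c' \<longleftrightarrow> (p', i') \<in> outst c"
    and status: "\<And>p'. p' \<noteq> p \<Longrightarrow> status c' p' = status c p'"
    and st: "status c p = Idle \<or> (\<exists>M q. status c p = Busy M q \<and> obj M = i)"
    and st': "status c' p = Idle \<or> (\<exists>M q. status c' p = Busy M q \<and> obj M = i)"
    and ok: "status_ok (status c' p) i (dict c' p i) ((p, i) \<in> outst c')"
    and R: "\<And>g. objR c' g = objR c g + of_bool (ref_at c' (p, i) = Some g) - of_bool (ref_at c (p, i) = Some g)"
  shows "consistent c'"
proof -
  have ref: "ref_at c' = (ref_at c)(((p, i)) := ref_at c' (p, i))"
  proof
    fix x :: "nat \<times> nat"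
    obtain p' i' where x: "x = (p', i')" by force
    show "ref_at c' x = ((ref_at c)((p, i) := ref_at c' (p, i))) x"
    proof (cases "x = (p, i)")
      case False
      then show ?thesis using x dict[of p' i'] status[of p'] st st'
        by (cases "p' = p") (auto simp: ref_at_def)
    qed simp
  qed
  have fin': "finite {x. ref_at c x \<noteq> None}"
    using ref_at_outst[OF c] c by (auto simp: consistent_def intro: finite_subset[of _ "outst c"])
  have "objR c' g = int (card {x. ref_at c' x = Some g})" for g
    using R[of g] card_fun_upd[OF fin', of "(p, i)" "ref_at c' (p, i)" g] c
    by (subst ref) (simp add: consistent_def)
  moreover have "status_ok (status c' p') i' (dict c' p' i') ((p', i') \<in> outst c')" for p' i'
  proof (cases "(p', i') = (p, i)")
    case False
    have "status_ok (status c p') i' (dict c p' i') ((p', i') \<in> outst c)"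
      using c by (simp add: consistent_def)
    with False show ?thesis using dict[OF False] outst[OF False] status[of p'] st st'
      by (cases "p' = p") auto
  qed (use ok in simp)
  ultimately show ?thesis using fin by (simp add: consistent_def)
qed

text \<open>The invariant does not mention the values of C and L, so they may become arbitrary, also
  by an overflow of C.\<close>

lemma snd_fai_C: "\<exists>C. snd (fai_C I ov i c) = c\<lparr>objC := C\<rparr>"
  by (auto simp: fai_C_def split: prod.splits)

lemma fad_C: "\<exists>r C. fad_C I ov i c = (r, c\<lparr>objC := C\<rparr>)"
  by (auto simp: fad_C_def split: prod.splits)

lemma cas_L: "\<exists>b L. cas_L i x y c = (b, c\<lparr>objL := L\<rparr>)"
  by (auto simp: cas_L_def split: prod.splits)

lemma snd_fai_R:
  assumes "consistent c" "x \<in> outst c" "ref_at c x = None" "card (outst c) \<le> bound I"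
  shows "snd (fai_R I ov g c) = c\<lparr>objR := (objR c)(g := objR c g + 1)\<rparr>"
proof -
  have "objR c g = int (card {x. ref_at c x = Some g})" using assms(1) by (simp add: consistent_def)
  then show ?thesis using card_refs_less[OF assms(1-3), of g] assms(4)
    by (simp add: fai_R_def fai_def)
qed

lemma snd_fad_R:
  assumes "consistent c" "ref_at c x = Some g" "card (outst c) \<le> bound I"
  shows "snd (fad_R I ov g c) = c\<lparr>objR := (objR c)(g := objR c g - 1)\<rparr>"
proof -
  have "objR c g = int (card {x. ref_at c x = Some g})" using assms(1) by (simp add: consistent_def)
  then show ?thesis using card_refs_pos[OF assms(1,2)] card_refs_le[OF assms(1), of g] assms(3)
    by (simp add: fad_R_def fad_def)
qed

lemmas local_defs = goto_def respond_def resume_def call_CL_def set_dict_def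

lemma consistent_init: "consistent (init_config I)"
  by (simp add: consistent_def init_config_def ref_at_def)

lemma consistent_invoke:
  assumes c: "consistent c" and idle: "status c p = Idle"
  shows "consistent (invoke p M c)"
proof -
  have ok: "status_ok Idle (obj M) (dict c p (obj M)) ((p, obj M) \<in> outst c)" and fin: "finite (outst c)"
    using c idle unfolding consistent_def by metis+
  show ?thesis
    by (rule consistent_update[OF c, where p = p and i = "obj M"]; insert ok fin idle; cases M)
      (auto simp: local_defs ref_at_def Let_def split: option.splits prod.splits cont.splits)
qed

lemma consistent_exec_line:
  assumes c: "consistent c" and busy: "status c p = Busy M q" and k: "card (outst c) \<le> bound I"
  shows "consistent (exec_line I ov smp p M q c)"
proof -
  have ok: "status_ok (Busy M q) (obj M) (dict c p (obj M)) ((p, obj M) \<in> outst c)"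
    and fin: "finite (outst c)"
    using c busy unfolding consistent_def by metis+
  obtain C where C: "snd (fai_C I ov (obj M) c) = c\<lparr>objC := C\<rparr>" using snd_fai_C by blast
  obtain r C' where C': "fad_C I ov (obj M) c = (r, c\<lparr>objC := C'\<rparr>)" using fad_C by metis
  \<comment> \<open>Increments occur at L6 and K7, where the pair holds nothing, and decrements at
    L9, K2 and K11, where it holds exactly the tag being released.\<close>
  have fai: "snd (fai_R I ov g c) = c\<lparr>objR := (objR c)(g := objR c g + 1)\<rparr>"
    if "ref_at c (p, obj M) = None" "(p, obj M) \<in> outst c" for g
    using snd_fai_R[OF c that(2,1) k] .
  have fad: "snd (fad_R I ov g c) = c\<lparr>objR := (objR c)(g := objR c g - 1)\<rparr>"
    if "ref_at c (p, obj M) = Some g" for g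
    using snd_fad_R[OF c that k] .
  obtain b L where L: "cas_L (obj M) x y c = (b x y, c\<lparr>objL := L x y\<rparr>)" for x y
    using cas_L by metis
  show ?thesis
  proof (cases q)
    case L2
    show ?thesis
      by (rule consistent_update[OF c, where p = p and i = "obj M"]; insert ok fin busy L2)
        (auto simp: exec_line_def local_defs ref_at_def C)
  next
    case L3
    show ?thesis
      by (rule consistent_update[OF c, where p = p and i = "obj M"]; insert ok fin busy L3)
        (auto simp: exec_line_def local_defs ref_at_def Let_def split: if_splits)
  next
    case (L6 x)
    show ?thesis
      by (rule consistent_update[OF c, where p = p and i = "obj M"]; insert ok fin busy L6 fai[of "snd x"])
        (auto simp: exec_line_def local_defs ref_at_def Let_def)
  next
    case (L7 x)
    show ?thesis
      by (rule consistent_update[OF c, where p = p and i = "obj M"]; insert ok fin busy L7)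
        (auto simp: exec_line_def local_defs ref_at_def Let_def split: prod.splits)
  next
    case (L9 x v)
    show ?thesis
      by (rule consistent_update[OF c, where p = p and i = "obj M"]; insert ok fin busy L9 fad[of "snd x"])
        (auto simp: exec_line_def local_defs ref_at_def Let_def)
  next
    case (S2 u)
    show ?thesis
      by (rule consistent_update[OF c, where p = p and i = "obj M"]; insert ok fin busy S2)
        (auto simp: exec_line_def local_defs ref_at_def Let_def)
  next
    case (S3 u g)
    show ?thesis
      by (rule consistent_update[OF c, where p = p and i = "obj M"]; insert ok fin busy S3)
        (auto simp: exec_line_def local_defs ref_at_def Let_def L split: if_splits)
  next
    case (S4 u g)
    show ?thesis
      by (rule consistent_update[OF c, where p = p and i = "obj M"]; insert ok fin busy S4)
        (auto simp: exec_line_def local_defs ref_at_def Let_def L split: if_splits)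
  next
    case (K2 \<kappa>)
    show ?thesis
      by (rule consistent_update[OF c, where p = p and i = "obj M"]; insert ok fin busy K2 fad[of "snd (the (dict c p (obj M)))"])
        (auto simp: exec_line_def local_defs ref_at_def Let_def)
  next
    case (K4 \<kappa>)
    show ?thesis
      by (rule consistent_update[OF c, where p = p and i = "obj M"]; insert ok fin busy K4)
        (auto simp: exec_line_def local_defs ref_at_def Let_def C' split: cont.splits)
  next
    case (K5 \<kappa>)
    show ?thesis
      by (rule consistent_update[OF c, where p = p and i = "obj M"]; insert ok fin busy K5)
        (auto simp: exec_line_def local_defs ref_at_def Let_def split: cont.splits)
  next
    case (K7 x \<kappa>)
    show ?thesis
      by (rule consistent_update[OF c, where p = p and i = "obj M"]; insert ok fin busy K7 fai[of "snd x"])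
        (auto simp: exec_line_def local_defs ref_at_def Let_def)
  next
    case (K8 x \<kappa>)
    show ?thesis
      by (rule consistent_update[OF c, where p = p and i = "obj M"]; insert ok fin busy K8)
        (auto simp: exec_line_def local_defs ref_at_def Let_def)
  next
    case (K9 x \<kappa>)
    show ?thesis
      by (rule consistent_update[OF c, where p = p and i = "obj M"]; insert ok fin busy K9)
        (auto simp: exec_line_def local_defs ref_at_def Let_def)
  next
    case (K10 x \<kappa>)
    show ?thesis
      by (rule consistent_update[OF c, where p = p and i = "obj M"]; insert ok fin busy K10)
        (auto simp: exec_line_def local_defs ref_at_def Let_def L)
  next
    case (K11 x \<kappa>)
    show ?thesis
      by (rule consistent_update[OF c, where p = p and i = "obj M"]; insert ok fin busy K11 fad[of "snd x"])
        (auto simp: exec_line_def local_defs ref_at_def Let_def split: cont.splits)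
  next
    case RD
    show ?thesis
      by (rule consistent_update[OF c, where p = p and i = "obj M"]; insert ok fin busy RD)
        (auto simp: exec_line_def local_defs ref_at_def Let_def)
  next
    case V2
    show ?thesis
      by (rule consistent_update[OF c, where p = p and i = "obj M"]; insert ok fin busy V2)
        (auto simp: exec_line_def local_defs ref_at_def Let_def split: if_splits)
  qed
qed


section \<open>A potential for the remaining steps of a call\<close>

text \<open>The weight of S2 exceeds the weight of S3 by 2, since a sample succeeds with probability at
  least 1/2.\<close>

fun cont_rank :: "'u cont \<Rightarrow> nat" where
  "cont_rank (Return r) = 0"
| "cont_rank ToL2 = 12"

text \<open>Except for S2, a weight is the length of the longest path of control flow to the
  response. \<open>CL\<close> takes up to 8 steps from K2, whence 9 for L7, S4 and V2, which may end
  by calling it, and 10 for S3, which may fall through to S4.\<close>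

fun pc_rank :: "'u pc \<Rightarrow> nat" where
  "pc_rank L2 = 12"
| "pc_rank L3 = 11"
| "pc_rank (L6 x) = 10"
| "pc_rank (L7 x) = 9"
| "pc_rank (L9 x v) = 1"
| "pc_rank (S2 u) = 12"
| "pc_rank (S3 u g) = 10"
| "pc_rank (S4 u g) = 9"
| "pc_rank (K2 \<kappa>) = 8 + cont_rank \<kappa>"
| "pc_rank (K4 \<kappa>) = 7 + cont_rank \<kappa>"
| "pc_rank (K5 \<kappa>) = 6 + cont_rank \<kappa>"
| "pc_rank (K7 x \<kappa>) = 5 + cont_rank \<kappa>"
| "pc_rank (K8 x \<kappa>) = 4 + cont_rank \<kappa>"
| "pc_rank (K9 x \<kappa>) = 3 + cont_rank \<kappa>"
| "pc_rank (K10 x \<kappa>) = 2 + cont_rank \<kappa>"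
| "pc_rank (K11 x \<kappa>) = 1 + cont_rank \<kappa>"
| "pc_rank RD = 1"
| "pc_rank V2 = 9"

fun rank :: "'u status \<Rightarrow> nat" where
  "rank Idle = 0"
| "rank (Busy M q) = pc_rank q"

lemma rank_le: "rank st \<le> 20"
proof -
  have *: "cont_rank \<kappa> \<le> 12" for \<kappa> :: "'u cont" by (cases \<kappa>) auto
  show ?thesis
  proof (cases st)
    case (Busy M q)
    then show ?thesis by (cases q) (auto intro: order_trans[OF *])
  qed simp
qed

section \<open>The effect of each transition on the rank\<close>

lemma goto_status [simp]: "status (goto p M q c) = (status c)(p := Busy M q)"
  by (simp add: goto_def)

lemma respond_status [simp]: "status (respond p M r c) = (status c)(p := Idle)"
  by (simp add: respond_def)

lemma set_dict_status [simp]: "status (set_dict p i x c) = status c"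
  by (simp add: set_dict_def)

lemma resume_status [simp]:
  "status (resume p M \<kappa> c) = (status c)(p := (case \<kappa> of Return r \<Rightarrow> Idle | ToL2 \<Rightarrow> Busy M L2))"
  by (simp add: resume_def split: cont.splits)

lemma FAID_status [simp]:
  "status (snd (fai_C I ov i c)) = status c" "status (snd (fad_C I ov i c)) = status c"
  "status (snd (fai_R I ov i c)) = status c" "status (snd (fad_R I ov i c)) = status c"
  by (simp_all add: fai_C_def fad_C_def fai_R_def fad_R_def split: prod.splits)

lemma CAS_status [simp]: "status (snd (cas_L i x y c)) = status c"
  by (simp add: cas_L_def split: prod.splits)

lemma call_CL_status_other [simp]: "p' \<noteq> p \<Longrightarrow> status (call_CL p M \<kappa> c) p' = status c p'"
  by (simp add: call_CL_def split: option.splits prod.splits)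

lemma rank_call_CL: "rank (status (call_CL p M \<kappa> c) p) \<le> 8 + cont_rank \<kappa>"
  by (simp add: call_CL_def split: option.splits prod.splits cont.splits)

lemma sampling_call_CL: "\<not> sampling (status (call_CL p M \<kappa> c) p)"
  by (simp add: call_CL_def split: option.splits prod.splits cont.splits)

lemma status_invoke_other: "p' \<noteq> p \<Longrightarrow> status (invoke p M c) p' = status c p'"
  by (cases M) (auto simp: Let_def)

lemma status_exec_line_other: "p' \<noteq> p \<Longrightarrow> status (exec_line I ov smp p M q c) p' = status c p'"
  by (cases q) (auto simp: exec_line_def Let_def case_prod_beta)

lemma sampling_invoke: "(\<nexists>i u. M = SC i u) \<Longrightarrow> \<not> sampling (status (invoke p M c) p)"
  by (cases M) (auto simp: Let_def sampling_call_CL)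

lemma exec_line_S2:
  "status (exec_line I ov smp p M (S2 u) c) p = Busy M (if objR c smp = 0 then S3 u smp else S2 u)"
  by (simp add: exec_line_def)

text \<open>S2 is the only loop; all other lines lead forward, and none of them leads back to S2.
  Hence a call that does not start in S2 never samples.\<close>

lemma rank_exec_line:
  assumes "\<not> sampling (Busy M q)"
  shows "rank (status (exec_line I ov smp p M q c) p) < pc_rank q"
    "\<not> sampling (status (exec_line I ov smp p M q c) p)"
proof -
  have call: "rank (status (call_CL p M (Return r) c') p) < 9" for r c'
    using rank_call_CL[of p M "Return r" c'] by simp
  have call': "rank (status (call_CL p M (Return r) c') p) < 10" for r c'
    using call[of r c'] by simp
  show "rank (status (exec_line I ov smp p M q c) p) < pc_rank q"
    using assms call call'
    by (cases q) (auto simp: exec_line_def Let_def case_prod_beta split: cont.splits)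
  show "\<not> sampling (status (exec_line I ov smp p M q c) p)"
    using assms sampling_call_CL
    by (cases q) (auto simp: exec_line_def Let_def case_prod_beta split: cont.splits)
qed


section \<open>Averaging over the next sample\<close>

text \<open>Such an \<open>f\<close> factors through \<open>stake n\<close> into a countable
  discrete space, on which every function is measurable; \<open>sconst 0\<close> is arbitrary
  padding.\<close>

lemma measurable_stake_cong:
  fixes f :: "nat stream \<Rightarrow> ennreal"
  assumes "\<And>\<omega> \<omega>'. stake n \<omega> = stake n \<omega>' \<Longrightarrow> f \<omega> = f \<omega>'"
  shows "f \<in> borel_measurable (stream_space (measure_pmf P))"
proof -
  have "f = (\<lambda>xs. f (xs @- sconst 0)) \<circ> stake n"
    by (auto simp: fun_eq_iff stake_shift intro!: assms)
  moreover have "stake n \<in> stream_space (measure_pmf P) \<rightarrow>\<^sub>M count_space UNIV"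
    using measurable_stake[of n, where ?'a = nat]
    by (simp cong: measurable_cong_sets add: sets_stream_space_cong[of "measure_pmf P" "count_space UNIV"])
  ultimately show ?thesis
    by (metis measurable_comp borel_measurable_count_space)
qed

text \<open>A substitute for conditioning on the first \<open>n\<close> samples: they are kept, and
  the sample at index \<open>n\<close> is averaged out. \<open>sconst x\<close> puts
  \<open>x\<close> at that index; what follows it does not influence \<open>f\<close>. The induction
  peels off the first sample.\<close>

lemma nn_integral_stake_Suc:
  fixes f :: "nat stream \<Rightarrow> ennreal"
  assumes "\<And>\<omega> \<omega>'. stake (Suc n) \<omega> = stake (Suc n) \<omega>' \<Longrightarrow> f \<omega> = f \<omega>'"
  shows "(\<integral>\<^sup>+\<omega>. f \<omega> \<partial>stream_space (measure_pmf P)) =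
    (\<integral>\<^sup>+\<omega>. (\<integral>\<^sup>+x. f (stake n \<omega> @- sconst x) \<partial>measure_pmf P) \<partial>stream_space (measure_pmf P))"
  using assms
proof (induction n arbitrary: f)
  case 0
  interpret S: prob_space "stream_space (measure_pmf P)"
    by (rule prob_space.prob_space_stream_space[OF prob_space_measure_pmf])
  have "(\<integral>\<^sup>+\<omega>. f \<omega> \<partial>stream_space (measure_pmf P)) =
      (\<integral>\<^sup>+x. (\<integral>\<^sup>+\<omega>. f (x ## \<omega>) \<partial>stream_space (measure_pmf P)) \<partial>measure_pmf P)"
    by (rule prob_space.nn_integral_stream_space[OF prob_space_measure_pmf]) (rule measurable_stake_cong[OF 0])
  also have "\<dots> = (\<integral>\<^sup>+x. (\<integral>\<^sup>+\<omega>. f (sconst x) \<partial>stream_space (measure_pmf P)) \<partial>measure_pmf P)"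
    by (intro nn_integral_cong 0) simp
  finally show ?case
    by (simp only: stake.simps shift.simps nn_integral_const S.emeasure_space_1 mult_1_right)
next
  case (Suc n)
  have "(\<integral>\<^sup>+\<omega>. f \<omega> \<partial>stream_space (measure_pmf P)) =
      (\<integral>\<^sup>+y. (\<integral>\<^sup>+\<omega>. f (y ## \<omega>) \<partial>stream_space (measure_pmf P)) \<partial>measure_pmf P)"
    by (rule prob_space.nn_integral_stream_space[OF prob_space_measure_pmf]) (rule measurable_stake_cong[OF Suc.prems])
  also have "\<dots> = (\<integral>\<^sup>+y. (\<integral>\<^sup>+\<omega>. (\<integral>\<^sup>+x. f (y ## stake n \<omega> @- sconst x)
      \<partial>measure_pmf P) \<partial>stream_space (measure_pmf P)) \<partial>measure_pmf P)"
    by (intro nn_integral_cong Suc.IH Suc.prems) simp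
  also have "\<dots> = (\<integral>\<^sup>+\<omega>. (\<integral>\<^sup>+x. f (stake (Suc n) \<omega> @- sconst x) \<partial>measure_pmf P)
      \<partial>stream_space (measure_pmf P))"
    by (subst prob_space.nn_integral_stream_space[OF prob_space_measure_pmf])
      (auto intro!: measurable_stake_cong[of "Suc n"])
  finally show ?case .
qed

text \<open>The measure lives on all streams of numbers, whereas \<open>weak_adversary\<close>
  speaks only of streams of legal tags.\<close>

lemma AE_samples: "bound I \<ge> 1 \<Longrightarrow> AE \<omega> in samples I. \<omega> \<in> streams {1..2 * bound I}"
proof -
  assume "bound I \<ge> 1"
  then have "AE x in measure_pmf (pmf_of_set {1..2 * bound I}). x \<in> {1..2 * bound I}"
    by (simp add: AE_measure_pmf_iff)
  then have "AE \<omega> in samples I. stream_all (\<lambda>x. x \<in> {1..2 * bound I}) \<omega>"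
    unfolding samples_def by (intro prob_space.AE_stream_all[OF prob_space_measure_pmf]) auto
  then show ?thesis by (simp add: stream_all_def streams_iff_sset subset_eq)
qed

text \<open>A sampling step costs 1 and leads to weight 10 (S3) if the entry is zero and to weight
  12 (S2) otherwise, hence 11 and 13; their mean 12 is the weight of S2. Raising each 11 by 2 gives
  the constant 13, which yields the bound.\<close>

lemma half_good_average:
  fixes R :: "nat \<Rightarrow> int"
  assumes "k \<le> card {g \<in> {1..2 * k}. R g = 0}"
  shows "(\<Sum>g\<in>{1..2 * k}. if R g = 0 then 11 else 13 :: nat) \<le> 2 * k * 12"
proof -
  let ?Z = "{g \<in> {1..2 * k}. R g = 0}"
  have "(\<Sum>g\<in>{1..2 * k}. (if R g = 0 then 11 else 13 :: nat)) + 2 * card ?Z =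
      (\<Sum>g\<in>{1..2 * k}. (if R g = 0 then 11 else 13) + 2 * of_bool (R g = 0))"
    by (simp add: sum.distrib Int_def flip: sum_distrib_left)
  also have "\<dots> = (\<Sum>g\<in>{1..2 * k}. 13)"
    by (rule sum.cong) auto
  finally show ?thesis using assms by simp
qed


section \<open>Executions\<close>

text \<open>The weakness of the adversary enters here: event t is chosen from the history alone, and
  sample t is used only afterwards.\<close>

lemma run_cong: "stake t \<omega> = stake t \<omega>' \<Longrightarrow> run I \<sigma> \<omega> t = run I \<sigma> \<omega>' t"
proof (induction t)
  case (Suc t)
  then have "stake t \<omega> = stake t \<omega>'" "\<omega> !! t = \<omega>' !! t" by (simp_all add: stake_Suc del: stake.simps)
  with Suc.IH show ?case by (simp only: run.simps)
qed simp

lemma config_at_0: "config_at I \<sigma> \<omega> 0 = init_config I"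
  by (simp add: config_at_def)

lemma config_at_Suc:
  "config_at I \<sigma> \<omega> (Suc t) = (case \<sigma> (history I \<sigma> \<omega> t) of
     None \<Rightarrow> config_at I \<sigma> \<omega> t
   | Some (Call p M) \<Rightarrow> invoke p M (config_at I \<sigma> \<omega> t)
   | Some (Sched p) \<Rightarrow> step I (overflow I (history I \<sigma> \<omega> t)) (\<omega> !! t) p (config_at I \<sigma> \<omega> t))"
  by (simp add: config_at_def history_def split: prod.splits option.splits action.splits)

lemma history_Suc:
  "history I \<sigma> \<omega> (Suc t) = (case \<sigma> (history I \<sigma> \<omega> t) of
     None \<Rightarrow> history I \<sigma> \<omega> t
   | Some (Call p M) \<Rightarrow> history I \<sigma> \<omega> t @ [Invoke p M]
   | Some (Sched p) \<Rightarrow> history I \<sigma> \<omega> t @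
       [Step p (if sampling (status (config_at I \<sigma> \<omega> t) p) then Some (\<omega> !! t) else None)])"
  by (simp add: config_at_def history_def split: prod.splits option.splits action.splits)

text \<open>The adversary sees only the history, so once it stops, the history is frozen. Until then
  list positions agree with event indices.\<close>

lemma length_history:
  "length (history I \<sigma> \<omega> t) \<le> t"
  "length (history I \<sigma> \<omega> t) \<noteq> t \<Longrightarrow> \<sigma> (history I \<sigma> \<omega> t) = None"
proof (induction t)
  case 0
  { case 1 show ?case by (simp add: history_def) }
  { case 2 then show ?case by (simp add: history_def) }
next
  case (Suc t)
  { case 1 show ?case using Suc by (simp add: history_Suc split: option.splits action.splits) }
  { case 2 then show ?case using Suc by (auto simp: history_Suc split: option.splits action.splits) }
qed

lemma event_at_eq:
  "event_at I \<sigma> \<omega> t = (case \<sigma> (history I \<sigma> \<omega> t) of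
     None \<Rightarrow> None
   | Some (Call p M) \<Rightarrow> Some (Invoke p M)
   | Some (Sched p) \<Rightarrow> 
       Some (Step p (if sampling (status (config_at I \<sigma> \<omega> t) p) then Some (\<omega> !! t) else None)))"
proof (cases "length (history I \<sigma> \<omega> t) = t")
  case True
  then show ?thesis
    by (auto simp: event_at_def Let_def history_Suc nth_append split: option.splits action.splits)
next
  case False
  then show ?thesis
    using length_history[of I \<sigma> \<omega> t] by (simp add: event_at_def Let_def history_Suc)
qed

lemma consistent_step:
  assumes "consistent c" "card (outst c) \<le> bound I"
  shows "consistent (step I ov smp p c)"
  using assms by (auto simp: step_def consistent_exec_line simp del: split_paired_All split: status.splits)

lemma admissibleD:
  assumes "weak_adversary I \<sigma>" "\<omega> \<in> streams {1..2 * bound I}" "\<sigma> (history I \<sigma> \<omega> t) = Some a"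
  shows "admissible I (config_at I \<sigma> \<omega> t) a"
  using assms by (simp add: weak_adversary_def)

lemma card_outst_le:
  assumes "weak_adversary I \<sigma>" "\<omega> \<in> streams {1..2 * bound I}"
  shows "card (outst (config_at I \<sigma> \<omega> t)) \<le> bound I"
  using assms by (simp add: weak_adversary_def)

lemma consistent_config_at:
  assumes "weak_adversary I \<sigma>" "\<omega> \<in> streams {1..2 * bound I}"
  shows "consistent (config_at I \<sigma> \<omega> t)"
proof (induction t)
  case 0
  show ?case by (simp add: config_at_0 consistent_init)
next
  case (Suc t)
  then show ?case
    using admissibleD[OF assms, of t] card_outst_le[OF assms, of t]
    by (auto simp: config_at_Suc consistent_invoke consistent_step split: option.splits action.splits)
qed

lemma card_zero_R:
  assumes "weak_adversary I \<sigma>" "\<omega> \<in> streams {1..2 * bound I}"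
  shows "bound I \<le> card {g \<in> {1..2 * bound I}. objR (config_at I \<sigma> \<omega> t) g = 0}"
proof -
  let ?R = "objR (config_at I \<sigma> \<omega> t)" and ?S = "{1..2 * bound I}"
  note c = consistent_config_at[OF assms, of t]
  have "2 * bound I = card ({g \<in> ?S. ?R g = 0} \<union> {g \<in> ?S. ?R g \<noteq> 0})"
    by (simp add: Un_def conj_disj_distribL[symmetric] flip: atLeastAtMost_iff del: atLeastAtMost_iff)
  also have "\<dots> = card {g \<in> ?S. ?R g = 0} + card {g \<in> ?S. ?R g \<noteq> 0}"
    by (rule card_Un_disjoint) auto
  also have "card {g \<in> ?S. ?R g \<noteq> 0} \<le> card {g. ?R g \<noteq> 0}"
    by (rule card_mono[OF card_nonzero_R_le(2)[OF c]]) auto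
  also have "\<dots> \<le> bound I"
    using card_nonzero_R_le(1)[OF c] card_outst_le[OF assms, of t] by simp
  finally show ?thesis by simp
qed


section \<open>The potential along an execution\<close>

context
  fixes I :: "'u instance_params" and \<sigma> :: "'u adversary" and p t :: nat and h\<^sub>0 :: "'u event list"
begin

text \<open>\<open>h\<^sub>0\<close> is the history up to and including the invocation by \<open>p\<close> at index \<open>t\<close>.\<close>

definition during :: "nat \<Rightarrow> nat stream \<Rightarrow> bool" where
  "during s \<omega> \<longleftrightarrow> history I \<sigma> \<omega> (Suc t) = h\<^sub>0 \<and>
     (\<forall>r M. t < r \<and> r < s \<longrightarrow> event_at I \<sigma> \<omega> r \<noteq> Some (Invoke p M))"

definition counted :: "nat \<Rightarrow> nat stream \<Rightarrow> nat" where
  "counted s \<omega> = of_bool (t < s \<and> during s \<omega> \<and> (\<exists>x. event_at I \<sigma> \<omega> s = Some (Step p x)))"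

text \<open>Set to 0 off \<open>during\<close>, so that a later invocation by \<open>p\<close>
  cannot raise it and its integral is bounded by a multiple of the probability of the
  prefix.\<close>

definition potential :: "nat \<Rightarrow> nat stream \<Rightarrow> nat" where
  "potential s \<omega> = (if during s \<omega> then rank (status (config_at I \<sigma> \<omega> s) p) else 0)"

lemma run_stake_cong:
  assumes "stake s \<omega> = stake s \<omega>'" "r \<le> s"
  shows "config_at I \<sigma> \<omega> r = config_at I \<sigma> \<omega>' r" "history I \<sigma> \<omega> r = history I \<sigma> \<omega>' r"
proof -
  have "stake r \<omega> = stake r \<omega>'"
    using arg_cong[OF assms(1), of "take r"] assms(2) by (simp add: take_stake min_def)
  then show "config_at I \<sigma> \<omega> r = config_at I \<sigma> \<omega>' r" "history I \<sigma> \<omega> r = history I \<sigma> \<omega>' r"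
    using run_cong by (metis config_at_def, metis history_def)
qed

lemma event_at_cong:
  assumes "stake s \<omega> = stake s \<omega>'" "r < s"
  shows "event_at I \<sigma> \<omega> r = event_at I \<sigma> \<omega>' r"
  using run_stake_cong(2)[OF assms(1), of "Suc r"] assms(2) by (simp add: event_at_def)

lemma during_cong:
  assumes "stake s \<omega> = stake s \<omega>'" "t < s"
  shows "during s \<omega> = during s \<omega>'"
  using run_stake_cong(2)[OF assms(1), of "Suc t"] event_at_cong[OF assms(1)] assms(2)
  by (simp add: during_def)

lemma potential_cong:
  assumes "stake s \<omega> = stake s \<omega>'" "t < s"
  shows "potential s \<omega> = potential s \<omega>'"
  using during_cong[OF assms] run_stake_cong(1)[OF assms(1), of s] by (simp add: potential_def)

lemma counted_cong:
  assumes "stake (Suc s) \<omega> = stake (Suc s) \<omega>'"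
  shows "counted s \<omega> = counted s \<omega>'"
proof (cases "t < s")
  case True
  have "stake s \<omega> = stake s \<omega>'" using assms by (simp add: stake_Suc del: stake.simps)
  then have "during s \<omega> = during s \<omega>'" using True by (rule during_cong)
  moreover have "event_at I \<sigma> \<omega> s = event_at I \<sigma> \<omega>' s" by (rule event_at_cong[OF assms]) simp
  ultimately show ?thesis by (simp only: counted_def)
qed (simp add: counted_def)

text \<open>As a series, the number of steps can be integrated term by term. Its value 0 off the
  prefix event builds the conditioning into the terms.\<close>

lemma suminf_counted:
  "(\<Sum>s. of_nat (counted s \<omega>)) =
     (if history I \<sigma> \<omega> (Suc t) = h\<^sub>0 then call_steps I \<sigma> \<omega> p t else 0)"
proof (cases "history I \<sigma> \<omega> (Suc t) = h\<^sub>0")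
  case True
  let ?S = "{s. s > t \<and> (\<exists>x. event_at I \<sigma> \<omega> s = Some (Step p x)) \<and>
         (\<forall>r M. t < r \<and> r < s \<longrightarrow> event_at I \<sigma> \<omega> r \<noteq> Some (Invoke p M))}"
  have "call_steps I \<sigma> \<omega> p t = (\<integral>\<^sup>+s. indicator ?S s \<partial>count_space UNIV)"
    unfolding call_steps_def by (rule nn_integral_indicator[symmetric]) simp
  also have "\<dots> = (\<Sum>s. indicator ?S s)"
    by (rule nn_integral_count_space_nat)
  also have "(\<lambda>s. indicator ?S s :: ennreal) = (\<lambda>s. of_nat (counted s \<omega>))"
    using True by (intro ext) (auto simp: counted_def during_def indicator_def simp del: not_ex not_all)
  finally show ?thesis using True by simp
qed (simp add: counted_def during_def)

lemma during_SucD: "during (Suc s) \<omega> \<Longrightarrow> during s \<omega>"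
  by (simp add: during_def)

text \<open>Only \<open>p\<close> itself changes its status. In \<open>other\<close>, the premise
  \<open>during (Suc s) \<omega>\<close> excludes a new invocation by \<open>p\<close>; in
  \<open>step\<close>, admissibility guarantees that \<open>p\<close> is busy.\<close>

lemma transition:
  assumes adv: "weak_adversary I \<sigma>" "\<omega> \<in> streams {1..2 * bound I}" and "t < s"
  obtains (other) "counted s \<omega> = 0"
      "during (Suc s) \<omega> \<Longrightarrow> status (config_at I \<sigma> \<omega> (Suc s)) p = status (config_at I \<sigma> \<omega> s) p"
  | (step) M q where "\<sigma> (history I \<sigma> \<omega> s) = Some (Sched p)" "status (config_at I \<sigma> \<omega> s) p = Busy M q"
      "status (config_at I \<sigma> \<omega> (Suc s)) p = status (exec_line I (overflow I (history I \<sigma> \<omega> s))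
         (\<omega> !! s) p M q (config_at I \<sigma> \<omega> s)) p"
proof (cases "\<sigma> (history I \<sigma> \<omega> s)")
  case None
  then show ?thesis
    by (intro other) (simp_all add: counted_def event_at_eq config_at_Suc)
next
  case (Some a)
  show ?thesis
  proof (cases a)
    case (Call p' M)
    have ev: "event_at I \<sigma> \<omega> s = Some (Invoke p' M)" using Some Call by (simp add: event_at_eq)
    then have "p' \<noteq> p" if "during (Suc s) \<omega>" using that \<open>t < s\<close> by (auto simp: during_def)
    then show ?thesis
      using Some Call ev by (intro other) (simp_all add: counted_def config_at_Suc status_invoke_other)
  next
    case (Sched p')
    have busy: "status (config_at I \<sigma> \<omega> s) p' \<noteq> Idle" using admissibleD[OF adv Some] Sched by simp
    show ?thesis
    proof (cases "p' = p")
      case True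
      with busy obtain M q where "status (config_at I \<sigma> \<omega> s) p = Busy M q"
        by (cases "status (config_at I \<sigma> \<omega> s) p") auto
      with True Some Sched show ?thesis by (intro step[of M q]) (simp_all add: config_at_Suc step_def)
    next
      case False
      with Some Sched show ?thesis
        by (intro other) (auto simp: counted_def event_at_eq config_at_Suc step_def
            status_exec_line_other split: status.splits)
    qed
  qed
qed

lemma potential_le: "potential s \<omega> \<le> 20"
  by (simp add: potential_def rank_le)

lemma counted_le: "counted s \<omega> \<le> of_bool (during s \<omega>)"
  by (simp add: counted_def)

text \<open>Off line S2 the decrease holds on every single execution. The second conjunct lets an
  induction re-establish \<open>ns\<close> for calls other than \<open>SC\<close>.\<close>

lemma potential_Suc:
  assumes adv: "weak_adversary I \<sigma>" "\<omega> \<in> streams {1..2 * bound I}" and "t < s"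
    and ns: "\<not> (\<sigma> (history I \<sigma> \<omega> s) = Some (Sched p) \<and> sampling (status (config_at I \<sigma> \<omega> s) p))"
  shows "counted s \<omega> + potential (Suc s) \<omega> \<le> potential s \<omega> \<and> (during (Suc s) \<omega> \<longrightarrow>
    \<not> sampling (status (config_at I \<sigma> \<omega> s) p) \<longrightarrow> \<not> sampling (status (config_at I \<sigma> \<omega> (Suc s)) p))"
  using adv \<open>t < s\<close>
proof (cases rule: transition)
  case other
  then show ?thesis using during_SucD by (simp add: potential_def)
next
  case (step M q)
  then have nq: "\<not> sampling (Busy M q)" using ns by simp
  note r = rank_exec_line[OF nq, of I "overflow I (history I \<sigma> \<omega> s)" "\<omega> !! s" p "config_at I \<sigma> \<omega> s"]
  have "counted s \<omega> + potential (Suc s) \<omega> \<le> potential s \<omega>"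
  proof (cases "during s \<omega>")
    case True
    then show ?thesis using step(2,3) r(1) counted_le[of s \<omega>] by (simp add: potential_def)
  next
    case False
    then show ?thesis using during_SucD[of s \<omega>] by (auto simp: potential_def counted_def)
  qed
  then show ?thesis using step(3) r(2) by simp
qed

lemma potential_Suc_sampling:
  assumes adv: "weak_adversary I \<sigma>" "\<omega> \<in> streams {1..2 * bound I}" and "t < s"
    and "\<sigma> (history I \<sigma> \<omega> s) = Some (Sched p)" "sampling (status (config_at I \<sigma> \<omega> s) p)"
    and "during s \<omega>"
  shows "counted s \<omega> + potential (Suc s) \<omega> \<le> (if objR (config_at I \<sigma> \<omega> s) (\<omega> !! s) = 0 then 11 else 13)"
    "potential s \<omega> = 12"
proof -
  from assms(5) obtain M u where st: "status (config_at I \<sigma> \<omega> s) p = Busy M (S2 u)"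
    by (auto elim: sampling.elims)
  then show "potential s \<omega> = 12" using assms(6) by (simp add: potential_def)
  have "status (config_at I \<sigma> \<omega> (Suc s)) p =
    Busy M (if objR (config_at I \<sigma> \<omega> s) (\<omega> !! s) = 0 then S3 u (\<omega> !! s) else S2 u)"
    using st assms(4) by (simp add: config_at_Suc step_def exec_line_S2)
  then show "counted s \<omega> + potential (Suc s) \<omega> \<le> (if objR (config_at I \<sigma> \<omega> s) (\<omega> !! s) = 0 then 11 else 13)"
    using counted_le[of s \<omega>] assms(6) by (simp add: potential_def)
qed

lemma call_steps_le:
  assumes adv: "weak_adversary I \<sigma>" "\<omega> \<in> streams {1..2 * bound I}"
    and "event_at I \<sigma> \<omega> t = Some (Invoke p M)" "\<nexists>i u. M = SC i u"
    and h: "history I \<sigma> \<omega> (Suc t) = h\<^sub>0"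
  shows "call_steps I \<sigma> \<omega> p t \<le> 20"
proof -
  \<comment> \<open>Up to index t the status of \<open>p\<close> does not yet concern this call,
    hence the guard \<open>t < T\<close>. At T = t + 1 nothing has been counted and the potential is
    at most 20.\<close>
  have *: "(\<Sum>s<T. counted s \<omega>) + (if t < T then potential T \<omega> else 0) \<le> 20 \<and>
    (t < T \<longrightarrow> during T \<omega> \<longrightarrow> \<not> sampling (status (config_at I \<sigma> \<omega> T) p))" for T
  proof (induction T)
    case (Suc T)
    show ?case
    proof (cases "t < T")
      case True
      show ?thesis
      proof (cases "during T \<omega>")
        case d: True
        then have "\<not> sampling (status (config_at I \<sigma> \<omega> T) p)" using Suc True by simp
        then have "counted T \<omega> + potential (Suc T) \<omega> \<le> potential T \<omega>"
          "during (Suc T) \<omega> \<longrightarrow> \<not> sampling (status (config_at I \<sigma> \<omega> (Suc T)) p)"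
          using potential_Suc[OF adv True] by blast+
        then show ?thesis using Suc True by simp
      next
        case False
        then have "\<not> during (Suc T) \<omega>" using during_SucD by blast
        then show ?thesis using Suc True False by (simp add: potential_def counted_def)
      qed
    next
      case False
      then have 0: "(\<Sum>s<Suc T. counted s \<omega>) = 0" by (simp add: counted_def)
      have "\<not> sampling (status (config_at I \<sigma> \<omega> (Suc t)) p)"
        using assms(3,4) sampling_invoke[of M p]
        by (auto simp: event_at_eq config_at_Suc split: option.splits action.splits)
      moreover have "T = t" if "t < Suc T" using that False by simp
      ultimately show ?thesis using potential_le[of "Suc T" \<omega>] by (auto simp add: 0 simp del: sum.lessThan_Suc)
    qed
  qed simp
  have "(\<Sum>s<T. of_nat (counted s \<omega>) :: ennreal) \<le> 20" for T
  proof -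
    have "(\<Sum>s<T. counted s \<omega>) \<le> 20" using *[of T] by linarith
    then have "(of_nat (\<Sum>s<T. counted s \<omega>) :: ennreal) \<le> of_nat 20" by (rule of_nat_mono)
    then show ?thesis by simp
  qed
  then have "(\<Sum>s. of_nat (counted s \<omega>) :: ennreal) \<le> 20"
    by (subst suminf_eq_SUP) (auto intro: SUP_least)
  then show ?thesis using h by (simp add: suminf_counted)
qed

text \<open>The supermartingale inequality in integrated form: in expectation, the potential pays
  for the counted step.\<close>

lemma nn_integral_potential_Suc:
  assumes "valid_params I" and adv: "weak_adversary I \<sigma>" and "t < s"
  shows "(\<integral>\<^sup>+\<omega>. of_nat (counted s \<omega> + potential (Suc s) \<omega>) \<partial>samples I) \<le>
    (\<integral>\<^sup>+\<omega>. of_nat (potential s \<omega>) \<partial>samples I)"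
proof -
  let ?S = "{1..2 * bound I}" and ?P = "pmf_of_set {1..2 * bound I}"
  let ?f = "\<lambda>\<omega>. counted s \<omega> + potential (Suc s) \<omega>"
  have k: "bound I \<ge> 1" using assms(1) by (simp add: valid_params_def)
  have cong: "?f \<omega> = ?f \<omega>'" if "stake (Suc s) \<omega> = stake (Suc s) \<omega>'" for \<omega> \<omega>'
    using counted_cong[OF that] potential_cong[OF that] \<open>t < s\<close> by simp
  have "(\<integral>\<^sup>+\<omega>. of_nat (?f \<omega>) \<partial>samples I) =
      (\<integral>\<^sup>+\<omega>. (\<integral>\<^sup>+x. of_nat (?f (stake s \<omega> @- sconst x)) \<partial>measure_pmf ?P) \<partial>samples I)"
    unfolding samples_def by (rule nn_integral_stake_Suc, rule arg_cong[where f = of_nat], rule cong)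
  also have "\<dots> \<le> (\<integral>\<^sup>+\<omega>. of_nat (potential s \<omega>) \<partial>samples I)"
  proof (rule nn_integral_mono_AE, use AE_samples[OF k] in eventually_elim)
    fix \<omega> assume \<omega>: "\<omega> \<in> streams ?S"
    \<comment> \<open>The execution with sample s replaced by x. It agrees with the original one
      before event s, so \<open>at\<close> transfers everything known then; x must be a legal tag
      for the adversary's constraints to apply.\<close>
    let ?\<omega> = "\<lambda>x. stake s \<omega> @- sconst x"
    have stake: "stake s (?\<omega> x) = stake s \<omega>" for x by (simp add: stake_shift)
    have str: "?\<omega> x \<in> streams ?S" if "x \<in> ?S" for x
    proof (rule shift_streams[OF _ sconst_streams[OF that]])
      show "stake s \<omega> \<in> lists ?S"
        using \<omega> snth_in[OF \<omega>] by (auto simp: in_set_conv_nth)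
    qed
    have x: "?\<omega> x !! s = x" for x by (simp add: shift_snth_ge)
    note at = run_stake_cong[OF stake order_refl] during_cong[OF stake \<open>t < s\<close>] potential_cong[OF stake \<open>t < s\<close>]
    have "(\<Sum>x\<in>?S. ?f (?\<omega> x)) \<le> 2 * bound I * potential s \<omega>"
    \<comment> \<open>The samples before s decide which case applies, so it is the same for all x.
      Only a sampling step of \<open>p\<close> needs the average; otherwise the bound holds for each
      x separately.\<close>
    proof (cases "during s \<omega> \<and> \<sigma> (history I \<sigma> \<omega> s) = Some (Sched p) \<and>
        sampling (status (config_at I \<sigma> \<omega> s) p)")
      case True
      have "potential s \<omega> = 12"
        using True by (intro potential_Suc_sampling(2)[OF adv \<omega> \<open>t < s\<close>]) auto
      moreover have "?f (?\<omega> x) \<le> (if objR (config_at I \<sigma> \<omega> s) x = 0 then 11 else 13)" if "x \<in> ?S" for x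
        using potential_Suc_sampling(1)[OF adv str[OF that] \<open>t < s\<close>] True by (simp add: at x)
      then have "(\<Sum>x\<in>?S. ?f (?\<omega> x)) \<le> (\<Sum>x\<in>?S. if objR (config_at I \<sigma> \<omega> s) x = 0 then 11 else 13)"
        by (rule sum_mono)
      moreover have "\<dots> \<le> 2 * bound I * 12"
        by (rule half_good_average[OF card_zero_R[OF adv \<omega>]])
      ultimately show ?thesis by simp
    next
      case False
      have "?f (?\<omega> x) \<le> potential s \<omega>" if "x \<in> ?S" for x
      proof (cases "during s \<omega>")
        case True
        then show ?thesis
          using potential_Suc[OF adv str[OF that] \<open>t < s\<close>] False by (simp add: at)
      next
        case False
        then have "\<not> during s (?\<omega> x)" by (simp add: at)
        then show ?thesis using during_SucD by (auto simp: potential_def counted_def)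
      qed
      then have "(\<Sum>x\<in>?S. ?f (?\<omega> x)) \<le> (\<Sum>x\<in>?S. potential s \<omega>)" by (rule sum_mono)
      then show ?thesis by simp
    qed
    then have "(of_nat (\<Sum>x\<in>?S. ?f (?\<omega> x)) :: ennreal) \<le> of_nat (2 * bound I * potential s \<omega>)"
      by (rule of_nat_mono)
    then have "(\<Sum>x\<in>?S. of_nat (?f (?\<omega> x)) :: ennreal) \<le> of_nat (2 * bound I) * of_nat (potential s \<omega>)"
      by (simp only: of_nat_sum of_nat_mult)
    then have "(\<Sum>x\<in>?S. of_nat (?f (?\<omega> x)) :: ennreal) / of_nat (card ?S) \<le> of_nat (potential s \<omega>)"
    proof (intro divide_le_posI_ennreal)
      show "(0 :: ennreal) < of_nat (card ?S)" using k by (subst of_nat_0_less_iff) simp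
    qed (simp add: mult.commute)
    then show "(\<integral>\<^sup>+x. of_nat (?f (?\<omega> x)) \<partial>measure_pmf ?P) \<le> of_nat (potential s \<omega>)"
      using k by (subst nn_integral_pmf_of_set) auto
  qed
  finally show ?thesis .
qed

lemma measurable_counted: "(\<lambda>\<omega>. of_nat (counted s \<omega>) :: ennreal) \<in> borel_measurable (samples I)"
  unfolding samples_def by (rule measurable_stake_cong, rule arg_cong[where f = of_nat], rule counted_cong)

lemma measurable_potential:
  "t < s \<Longrightarrow> (\<lambda>\<omega>. of_nat (potential s \<omega>) :: ennreal) \<in> borel_measurable (samples I)"
  unfolding samples_def by (rule measurable_stake_cong, rule arg_cong[where f = of_nat], erule (1) potential_cong)

lemma sets_prefix_event: "prefix_event I \<sigma> h \<in> sets (samples I)"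
proof -
  have "(\<lambda>\<omega>. of_bool (history I \<sigma> \<omega> (length h) = h) :: ennreal) \<in> borel_measurable (samples I)"
    unfolding samples_def
    by (rule measurable_stake_cong[of "length h"]) (drule run_stake_cong(2)[OF _ order_refl], simp)
  then have "(\<lambda>\<omega>. of_bool (history I \<sigma> \<omega> (length h) = h) :: ennreal) -` {1} \<inter> space (samples I) \<in> sets (samples I)"
    by (rule measurable_sets) simp
  also have "(\<lambda>\<omega>. of_bool (history I \<sigma> \<omega> (length h) = h) :: ennreal) -` {1} \<inter> space (samples I) = prefix_event I \<sigma> h"
    by (auto simp: prefix_event_def)
  finally show ?thesis .
qed

lemma expected_call_steps_le:
  assumes "valid_params I" and adv: "weak_adversary I \<sigma>" and h: "length h\<^sub>0 = Suc t"
    and pos: "emeasure (samples I) (prefix_event I \<sigma> h\<^sub>0) > 0"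
  shows "expected_call_steps I \<sigma> h\<^sub>0 p \<le> 20"
proof -
  let ?A = "prefix_event I \<sigma> h\<^sub>0"
  \<comment> \<open>The same telescoping as for a single execution, now with integrals. The initial
    potential is at most 20 on the prefix event and 0 off it, which gives the factor on the
    right.\<close>
  have *: "(\<Sum>s<T. (\<integral>\<^sup>+\<omega>. of_nat (counted s \<omega>) \<partial>samples I)) +
      (if t < T then (\<integral>\<^sup>+\<omega>. of_nat (potential T \<omega>) \<partial>samples I) else 0) \<le> 20 * emeasure (samples I) ?A" for T
  proof (induction T)
    case (Suc T)
    show ?case
    proof (cases "t < T")
      case True
      have "(\<integral>\<^sup>+\<omega>. of_nat (counted T \<omega>) \<partial>samples I) + (\<integral>\<^sup>+\<omega>. of_nat (potential (Suc T) \<omega>) \<partial>samples I) =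
          (\<integral>\<^sup>+\<omega>. of_nat (counted T \<omega> + potential (Suc T) \<omega>) \<partial>samples I)"
        using True by (simp add: nn_integral_add measurable_counted measurable_potential)
      also have "\<dots> \<le> (\<integral>\<^sup>+\<omega>. of_nat (potential T \<omega>) \<partial>samples I)"
        by (rule nn_integral_potential_Suc[OF assms(1) adv True])
      finally show ?thesis
        using Suc True by (simp add: add.assoc) (meson add_left_mono order_trans)
    next
      case False
      then have 0: "(\<Sum>s<Suc T. (\<integral>\<^sup>+\<omega>. of_nat (counted s \<omega>) \<partial>samples I)) = 0"
        by (simp add: counted_def)
      show ?thesis
      proof (cases "t < Suc T")
        case True
        have "(\<integral>\<^sup>+\<omega>. of_nat (potential (Suc T) \<omega>) \<partial>samples I) \<le> (\<integral>\<^sup>+\<omega>. 20 * indicator ?A \<omega> \<partial>samples I)"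
        proof (rule nn_integral_mono)
          fix \<omega> assume "\<omega> \<in> space (samples I)"
          then have "potential (Suc T) \<omega> \<le> 20 * indicator ?A \<omega>"
            using potential_le[of "Suc T" \<omega>] h
            by (auto simp: potential_def during_def prefix_event_def indicator_def)
          then have "(of_nat (potential (Suc T) \<omega>) :: ennreal) \<le> of_nat (20 * indicator ?A \<omega>)"
            by (rule of_nat_mono)
          then show "(of_nat (potential (Suc T) \<omega>) :: ennreal) \<le> 20 * indicator ?A \<omega>"
            by (simp add: indicator_def split: if_splits)
        qed
        also have "\<dots> = 20 * emeasure (samples I) ?A"
          by (simp add: nn_integral_cmult_indicator sets_prefix_event)
        finally show ?thesis unfolding 0 by simp
      qed (simp only: 0, simp)
    qed
  qed simp
  \<comment> \<open>\<open>?F\<close> vanishes off \<open>?A\<close>, so its unrestricted integral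
    divided by the probability of \<open>?A\<close> is the conditional expectation.\<close>
  let ?F = "\<lambda>\<omega>. \<Sum>s. of_nat (counted s \<omega>) :: ennreal"
  have F: "?F \<in> borel_measurable (samples I)"
    by (rule borel_measurable_suminf_order) (rule measurable_counted)
  have "(\<integral>\<^sup>+\<omega>. ?F \<omega> * indicator ?A \<omega> \<partial>samples I) \<le> (\<integral>\<^sup>+\<omega>. ?F \<omega> \<partial>samples I)"
    by (rule nn_integral_mono) (simp add: indicator_def)
  also have "\<dots> = (\<Sum>s. (\<integral>\<^sup>+\<omega>. of_nat (counted s \<omega>) \<partial>samples I))"
    by (rule nn_integral_suminf) (rule measurable_counted)
  also have "\<dots> \<le> 20 * emeasure (samples I) ?A"
    unfolding suminf_eq_SUP
  proof (rule SUP_least)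
    fix T
    show "(\<Sum>s<T. (\<integral>\<^sup>+\<omega>. of_nat (counted s \<omega>) \<partial>samples I)) \<le> 20 * emeasure (samples I) ?A"
      using *[of T] by (rule order_trans[rotated]) simp
  qed
  finally have "(\<integral>\<^sup>+\<omega>. ?F \<omega> * indicator ?A \<omega> \<partial>samples I) / emeasure (samples I) ?A \<le> 20"
    using pos by (intro divide_le_posI_ennreal) (simp_all add: mult.commute)
  moreover have "expected_call_steps I \<sigma> h\<^sub>0 p = (\<integral>\<^sup>+\<omega>. ?F \<omega> \<partial>uniform_measure (samples I) ?A)"
    unfolding expected_call_steps_def
  \<comment> \<open>Off \<open>?A\<close> the two integrands may differ, but the conditional measure
    puts no mass there.\<close>
  proof (rule nn_integral_cong_AE, rule AE_uniform_measureI[OF sets_prefix_event], rule AE_I2, rule impI)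
    fix \<omega> assume "\<omega> \<in> ?A"
    then show "call_steps I \<sigma> \<omega> p (length h\<^sub>0 - 1) = ?F \<omega>"
      using h by (simp add: suminf_counted prefix_event_def)
  qed
  ultimately show ?thesis
    by (simp add: nn_integral_uniform_measure[OF F sets_prefix_event])
qed

end

theorem theorem7:
  shows "\<exists>c :: nat. \<forall>(I :: 'u instance_params) \<sigma>. valid_params I \<longrightarrow> weak_adversary I \<sigma> \<longrightarrow>
    (\<forall>\<omega>\<in>streams {1..2 * bound I}. \<forall>t p i. \<forall>M\<in>{LL i, CL i, Rd i, VL i}.
       event_at I \<sigma> \<omega> t = Some (Invoke p M) \<longrightarrow> call_steps I \<sigma> \<omega> p t \<le> of_nat c) \<and>
    (\<forall>h p i u. emeasure (samples I) (prefix_event I \<sigma> (h @ [Invoke p (SC i u)])) > 0 \<longrightarrow>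
       expected_call_steps I \<sigma> (h @ [Invoke p (SC i u)]) p \<le> of_nat c)"
proof (intro exI[of _ 20] allI impI conjI ballI)
  fix I :: "'u instance_params" and \<sigma> \<omega> t p i M
  assume "weak_adversary I \<sigma>" "\<omega> \<in> streams {1..2 * bound I}" "M \<in> {LL i, CL i, Rd i, VL i}"
    "event_at I \<sigma> \<omega> t = Some (Invoke p M)"
  then show "call_steps I \<sigma> \<omega> p t \<le> of_nat 20"
    \<comment> \<open>For a fixed execution, its own history serves as the prefix.\<close>
    using call_steps_le[of I \<sigma> \<omega> t p M "history I \<sigma> \<omega> (Suc t)"] by auto
next
  fix I :: "'u instance_params" and \<sigma> h p i u
  assume "valid_params I" "weak_adversary I \<sigma>"
    "emeasure (samples I) (prefix_event I \<sigma> (h @ [Invoke p (SC i u)])) > 0"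
  then show "expected_call_steps I \<sigma> (h @ [Invoke p (SC i u)]) p \<le> of_nat 20"
    using expected_call_steps_le[of I \<sigma> "h @ [Invoke p (SC i u)]" "length h" p] by simp
qed

end
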